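(* Let $T$ be a finite labelled rooted tree, $V=\{[u]_\sim:u\in T\}$, $S=[\mathrm{root}(T)]_\sim$, and let $s:V\to T$ be an injective map with $[s(a)]_\sim=a$ for all $a\in V$ such that every $q\neq S$ admits some $p\in V$ with $(p,q)$ an edge of $G$ and $s(q)\in\mathrm{children}(s(p))$. Let $\mathcal{R}(T)$ (the DAG-RW compression) be the multigraph with vertex set $V$, vertex labels $L_V(q)=\overline{s(q)}$, and edges the triples $(p,q,v)$ with $p,q\in V$, $v\in\mathrm{children}(s(p))$, $[v]_\sim=q$, each carrying the label $L_E(p,q,v)=f_\phi:\mathrm{attr}(T(s(q)))\to\mathrm{attr}(T(v))$, the cipher of a chosen tree ciphering $\phi$ from $T(s(q))$ onto $T(v)$ (the identity when $v=s(q)$). Then $\mathcal{R}(T)$ is a lossless compression of $T$: let $\widehat{T}$ be the labelled rooted tree whose nodes are the finite paths of edges $(e_1,\dots,e_m)$ in $\mathcal{R}(T)$ starting at $S$ ($m\geq 0$; the empty path is the root), where the children of a path ending at vertex $p$ are its extensions by one edge leaving $p$, and where the label of the empty path is $L_V(S)$ and the label of a path $(e_1,\dots,e_m)$, $m\geq1$, ending at vertex $p_m$ is $\big(L_E(e_1)\circ\cdots\circ L_E(e_m)\big)(L_V(p_m))$. Then there is a labelled tree isomorphism between $\widehat{T}$ and $T$ (a bijection preserving the parent–child relation and the labels).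
   Context: A labelled rooted tree $T$ is a finite rooted tree (edges directed from parent to child), each node $u$ carrying a label $\overline{u}$; $\mathrm{attr}(T)=\{\overline{u}:u\in T\}$; $\mathrm{children}(u)$ is the set of children of $u$ and $T(u)$ is the labelled subtree formed by $u$ and its descendants. A tree isomorphism $\phi:T_1\to T_2$ is a bijection on nodes such that $u$ is a child of $v$ iff $\phi(u)$ is a child of $\phi(v)$; it is a tree ciphering if there is a bijection $f_\phi:\mathrm{attr}(T_1)\to\mathrm{attr}(T_2)$ (the cipher) with $\overline{\phi(u)}=f_\phi(\overline{u})$ for all $u\in T_1$. $T_1\sim T_2$ means a tree ciphering exists (an equivalence relation); $[u]_\sim$ is the class of $T(u)$. $G$ denotes the directed multigraph on $V$ in which $(p,q)$ has multiplicity equal to the largest $k$ such that some node $u$ with $[u]_\sim=p$ has $k$ distinct children of class $q$; $S$ is its unique source. *)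

theory Defs
  imports "HOL-Library.FuncSet" "Graph_Theory.Graph_Theory"
begin

record ('n, 'l) ltree =
  nodes :: "'n set"
  root :: "'n"
  edges :: "('n \<times> 'n) set"  \<comment> \<open>pairs (parent, child)\<close>
  label :: "'n \<Rightarrow> 'l"  \<comment> \<open>relevant on the nodes only\<close>

definition labelled_rooted_tree :: "('n, 'l) ltree \<Rightarrow> bool" where
  "labelled_rooted_tree T \<longleftrightarrow>
     finite (nodes T) \<and> root T \<in> nodes T \<and> edges T \<subseteq> nodes T \<times> nodes T \<and>
     (\<forall>u. (u, root T) \<notin> edges T) \<and>
     (\<forall>v \<in> nodes T - {root T}. \<exists>!u. (u, v) \<in> edges T) \<and>
     (\<forall>v \<in> nodes T. (root T, v) \<in> (edges T)\<^sup>*)"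

definition children :: "('n, 'l) ltree \<Rightarrow> 'n \<Rightarrow> 'n set" where
  "children T u = {v. (u, v) \<in> edges T}"

definition attr :: "('n, 'l) ltree \<Rightarrow> 'l set" where
  "attr T = label T ` nodes T"

definition subtree :: "('n, 'l) ltree \<Rightarrow> 'n \<Rightarrow> ('n, 'l) ltree" where
  "subtree T u =
     (let D = {v \<in> nodes T. (u, v) \<in> (edges T)\<^sup>*}
      in \<lparr>nodes = D, root = u, edges = edges T \<inter> D \<times> D, label = label T\<rparr>)"

definition tree_iso :: "('m, 'k) ltree \<Rightarrow> ('n, 'l) ltree \<Rightarrow> ('m \<Rightarrow> 'n) \<Rightarrow> bool" where
  "tree_iso T1 T2 \<phi> \<longleftrightarrow>
     bij_betw \<phi> (nodes T1) (nodes T2) \<and>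
     (\<forall>u \<in> nodes T1. \<forall>v \<in> nodes T1. u \<in> children T1 v \<longleftrightarrow> \<phi> u \<in> children T2 (\<phi> v))"

definition labelled_tree_iso :: "('m, 'l) ltree \<Rightarrow> ('n, 'l) ltree \<Rightarrow> ('m \<Rightarrow> 'n) \<Rightarrow> bool" where
  "labelled_tree_iso T1 T2 \<phi> \<longleftrightarrow>
     tree_iso T1 T2 \<phi> \<and> (\<forall>u \<in> nodes T1. label T2 (\<phi> u) = label T1 u)"

text \<open>A cipher is a function with domain \<^term>\<open>attr T1\<close>; extensionality makes it uniquely
  determined by the isomorphism.\<close>

definition is_cipher ::
  "('m, 'k) ltree \<Rightarrow> ('n, 'l) ltree \<Rightarrow> ('m \<Rightarrow> 'n) \<Rightarrow> ('k \<Rightarrow> 'l) \<Rightarrow> bool" where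
  "is_cipher T1 T2 \<phi> f \<longleftrightarrow>
     f \<in> extensional (attr T1) \<and> bij_betw f (attr T1) (attr T2) \<and>
     (\<forall>u \<in> nodes T1. label T2 (\<phi> u) = f (label T1 u))"

definition tree_ciphering :: "('m, 'k) ltree \<Rightarrow> ('n, 'l) ltree \<Rightarrow> ('m \<Rightarrow> 'n) \<Rightarrow> bool" where
  "tree_ciphering T1 T2 \<phi> \<longleftrightarrow> tree_iso T1 T2 \<phi> \<and> (\<exists>f. is_cipher T1 T2 \<phi> f)"

definition cipher :: "('m, 'k) ltree \<Rightarrow> ('n, 'l) ltree \<Rightarrow> ('m \<Rightarrow> 'n) \<Rightarrow> 'k \<Rightarrow> 'l" where
  "cipher T1 T2 \<phi> = (THE f. is_cipher T1 T2 \<phi> f)"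

definition cipher_rel :: "('n, 'l) ltree rel" where
  "cipher_rel = {(T1, T2). labelled_rooted_tree T1 \<and> labelled_rooted_tree T2 \<and>
                           (\<exists>\<phi>. tree_ciphering T1 T2 \<phi>)}"

type_synonym ('n, 'l) tree_class = "('n, 'l) ltree set"

definition node_class :: "('n, 'l) ltree \<Rightarrow> 'n \<Rightarrow> ('n, 'l) tree_class" where
  "node_class T u = cipher_rel `` {subtree T u}"

definition classes :: "('n, 'l) ltree \<Rightarrow> ('n, 'l) tree_class set" where
  "classes T = node_class T ` nodes T"

definition multiplicity_in_reduction ::
  "('n, 'l) ltree \<Rightarrow> ('n, 'l) tree_class \<Rightarrow> ('n, 'l) tree_class \<Rightarrow> nat" where
  "multiplicity_in_reduction T p q =
     Max {card {v \<in> children T u. node_class T v = q} | u. u \<in> nodes T \<and> node_class T u = p}"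

text \<open>The multigraph \<open>G\<close>: parallel arcs from \<open>p\<close> to \<open>q\<close> are numbered from 0.\<close>

definition reduction_graph ::
  "('n, 'l) ltree \<Rightarrow>
   (('n, 'l) tree_class, ('n, 'l) tree_class \<times> ('n, 'l) tree_class \<times> nat) pre_digraph" where
  "reduction_graph T =
     \<lparr>verts = classes T,
      arcs = {(p, q, i). p \<in> classes T \<and> q \<in> classes T \<and> i < multiplicity_in_reduction T p q},
      tail = (\<lambda>(p, q, i). p),
      head = (\<lambda>(p, q, i). q)\<rparr>"

record ('v, 'e, 'l) labelled_multigraph =
  underlying :: "('v, 'e) pre_digraph"
  vertex_label :: "'v \<Rightarrow> 'l"
  edge_label :: "'e \<Rightarrow> 'l \<Rightarrow> 'l"

type_synonym ('n, 'l) rw_edge = "('n, 'l) tree_class \<times> ('n, 'l) tree_class \<times> 'n"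

definition rw_edges ::
  "('n, 'l) ltree \<Rightarrow> (('n, 'l) tree_class \<Rightarrow> 'n) \<Rightarrow> ('n, 'l) rw_edge set" where
  "rw_edges T s =
     {(p, q, v). p \<in> classes T \<and> q \<in> classes T \<and> v \<in> children T (s p) \<and> node_class T v = q}"

text \<open>The DAG-RW compression for a choice \<open>s\<close> of representatives and a choice
  \<open>\<Phi> (p, q, v)\<close> of a ciphering from \<open>T(s(q))\<close> onto \<open>T(v)\<close> for each edge.\<close>

definition dag_rw ::
  "('n, 'l) ltree \<Rightarrow> (('n, 'l) tree_class \<Rightarrow> 'n) \<Rightarrow> (('n, 'l) rw_edge \<Rightarrow> 'n \<Rightarrow> 'n) \<Rightarrow>
   (('n, 'l) tree_class, ('n, 'l) rw_edge, 'l) labelled_multigraph" where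
  "dag_rw T s \<Phi> =
     \<lparr>underlying =
        \<lparr>verts = classes T,
         arcs = rw_edges T s,
         tail = (\<lambda>(p, q, v). p),
         head = (\<lambda>(p, q, v). q)\<rparr>,
      vertex_label = (\<lambda>q. label T (s q)),
      edge_label = (\<lambda>(p, q, v). cipher (subtree T (s q)) (subtree T v) (\<Phi> (p, q, v)))\<rparr>"

definition paths_from :: "('v, 'e) pre_digraph \<Rightarrow> 'v \<Rightarrow> 'e list set" where
  "paths_from G S = {es. \<exists>p. pre_digraph.awalk G S es p}"

definition decompress :: "('v, 'e, 'l) labelled_multigraph \<Rightarrow> 'v \<Rightarrow> ('e list, 'l) ltree" where
  "decompress R S =
     \<lparr>nodes = paths_from (underlying R) S,
      root = [],
      edges = {(es, es @ [e]) | es e.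
                 es \<in> paths_from (underlying R) S \<and>
                 e \<in> out_arcs (underlying R) (pre_digraph.awlast (underlying R) S es)},
      label = (\<lambda>es. foldr (\<circ>) (map (edge_label R) es) id
                      (vertex_label R (pre_digraph.awlast (underlying R) S es)))\<rparr>"

end

theory Submission
  imports Defs
begin

text \<open>
  Composing the chosen cipherings along a path of edges \<open>(e\<^sub>1, \<dots>, e\<^sub>m)\<close> from \<open>S\<close> to \<open>p\<close> embeds
  \<open>T(s(p))\<close> as a full subtree of \<open>T\<close>, the labels being transported by the composed ciphers.
  The path is sent to the root of this subtree. The edges leaving \<open>p\<close> correspond bijectively to the
  children of \<open>s(p)\<close>, hence to the children of the image node; as \<open>s(S)\<close> is the root of \<open>T\<close>,
  the map so defined is an isomorphism: injective because parents are unique, surjective because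
  every node is reachable from the root.
\<close>

section \<open>Rooted trees and their subtrees\<close>

lemma parent_unique:
  assumes "labelled_rooted_tree T" "(u, v) \<in> edges T" "(u', v) \<in> edges T"
  shows "u = u'"
  using assms unfolding labelled_rooted_tree_def by blast

lemma children_nodes:
  assumes "labelled_rooted_tree T" "v \<in> children T u"
  shows "v \<in> nodes T"
  using assms unfolding labelled_rooted_tree_def children_def by blast

text \<open>Induction along a path from the root. The root has no incoming edge; and since parents
  are unique, a cycle through \<open>b\<close> must also pass through its parent \<open>a\<close>,
  where the induction hypothesis excludes it.\<close>

lemma labelled_rooted_tree_acyclic:
  assumes T: "labelled_rooted_tree T"
  shows "(x, x) \<notin> (edges T)\<^sup>+"
proof
  assume cycle: "(x, x) \<in> (edges T)\<^sup>+"
  then obtain y where "(y, x) \<in> edges T"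
    by (metis tranclE)
  then have "x \<in> nodes T"
    using T unfolding labelled_rooted_tree_def by blast
  then have "(root T, x) \<in> (edges T)\<^sup>*"
    using T unfolding labelled_rooted_tree_def by blast
  then have "(x, x) \<notin> (edges T)\<^sup>+"
  proof (induction rule: rtrancl_induct)
    case base
    show ?case
      using T unfolding labelled_rooted_tree_def by (metis tranclE)
  next
    case (step a b)
    show ?case
    proof
      assume "(b, b) \<in> (edges T)\<^sup>+"
      then obtain c where c: "(b, c) \<in> (edges T)\<^sup>*" "(c, b) \<in> edges T"
        by (meson tranclD2)
      then have "c = a"
        using parent_unique[OF T] step.hyps(2) by blast
      then have "(a, a) \<in> (edges T)\<^sup>+"
        using c step.hyps(2) by (meson rtrancl_into_trancl2)
      with step.IH show False ..
    qed
  qed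
  with cycle show False by contradiction
qed

lemma nodes_subtree: "nodes (subtree T u) = {v \<in> nodes T. (u, v) \<in> (edges T)\<^sup>*}"
  by (simp add: subtree_def Let_def)

lemma label_subtree [simp]: "label (subtree T u) = label T"
  by (simp add: subtree_def Let_def)

lemma self_in_subtree: "u \<in> nodes T \<Longrightarrow> u \<in> nodes (subtree T u)"
  by (simp add: nodes_subtree)

lemma children_subtree_subset:
  assumes "labelled_rooted_tree T" "x \<in> nodes (subtree T u)"
  shows "children T x \<subseteq> nodes (subtree T u)"
  using assms children_nodes[OF assms(1)]
  by (auto simp: nodes_subtree children_def intro: rtrancl_into_rtrancl)

lemma children_subtree:
  assumes "labelled_rooted_tree T" "x \<in> nodes (subtree T u)"
  shows "children (subtree T u) x = children T x"
  using children_subtree_subset[OF assms] assms(2)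
  by (auto simp: subtree_def Let_def children_def)

lemma subtree_mono:
  assumes "v \<in> children T u"
  shows "nodes (subtree T v) \<subseteq> nodes (subtree T u)"
  using assms by (auto simp: nodes_subtree children_def intro: converse_rtrancl_into_rtrancl)

lemma subtree_root:
  fixes T :: "('n, 'l) ltree"
  assumes "labelled_rooted_tree T"
  shows "subtree T (root T) = T"
proof -
  have "{v \<in> nodes T. (root T, v) \<in> (edges T)\<^sup>*} = nodes T"
    using assms unfolding labelled_rooted_tree_def by blast
  moreover have "edges T \<inter> nodes T \<times> nodes T = edges T"
    using assms unfolding labelled_rooted_tree_def by blast
  ultimately show ?thesis
    by (simp add: subtree_def)
qed

section \<open>Cipherings and isomorphisms between subtrees\<close>

lemma tree_ciphering_id: "tree_ciphering T T id"
  unfolding tree_ciphering_def tree_iso_def is_cipher_def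
  \<comment> \<open>The identity is restricted to the labels because ciphers are
    extensional.\<close>
  by (auto simp: attr_def intro!: exI[of _ "restrict id (label T ` nodes T)"] bij_betw_imageI inj_onI)

text \<open>A ciphering preserves the number of nodes, so by finiteness T(u) can only be equivalent
  to T if it contains every node; then the root lies below \<open>u\<close>, and having no parent it
  equals \<open>u\<close>. This later pins down the representative of the source.\<close>

lemma node_class_eq_root_class_iff:
  fixes T :: "('n, 'l) ltree"
  assumes T: "labelled_rooted_tree T" and u: "u \<in> nodes T"
  shows "node_class T u = node_class T (root T) \<longleftrightarrow> u = root T"
proof
  assume eq: "node_class T u = node_class T (root T)"
  \<comment> \<open>Reflexivity places T in the class of \<open>u\<close>, which by definition
    yields a ciphering from T(u) onto T.\<close>
  have "T \<in> node_class T (root T)"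
    using T tree_ciphering_id[of T] by (auto simp: node_class_def subtree_root cipher_rel_def)
  with eq obtain \<phi> where "tree_ciphering (subtree T u) T \<phi>"
    by (auto simp: node_class_def cipher_rel_def)
  then have "card (nodes (subtree T u)) = card (nodes T)"
    by (auto simp: tree_ciphering_def tree_iso_def dest: bij_betw_same_card)
  moreover have "nodes (subtree T u) \<subseteq> nodes T" "finite (nodes T)"
    using T by (auto simp: nodes_subtree labelled_rooted_tree_def)
  ultimately have "nodes (subtree T u) = nodes T"
    by (metis card_subset_eq)
  then have "(u, root T) \<in> (edges T)\<^sup>*"
    using T by (auto simp: nodes_subtree labelled_rooted_tree_def)
  then show "u = root T"
    using T unfolding labelled_rooted_tree_def by (metis rtranclE)
qed simp

text \<open>Subtrees are closed under children, so children may be taken in the whole tree;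
  surjectivity of \<phi> supplies the preimages of the children of \<open>\<phi> x\<close>.\<close>

lemma tree_iso_subtree_children:
  assumes T: "labelled_rooted_tree T"
    and iso: "tree_iso (subtree T u) (subtree T v) \<phi>"
    and x: "x \<in> nodes (subtree T u)"
  shows "children T (\<phi> x) = \<phi> ` children T x"
proof -
  let ?U = "nodes (subtree T u)" and ?V = "nodes (subtree T v)"
  have bij: "bij_betw \<phi> ?U ?V"
    using iso by (simp add: tree_iso_def)
  then have \<phi>x: "\<phi> x \<in> ?V"
    using x by (auto simp: bij_betw_def)
  have iff: "y \<in> children T x \<longleftrightarrow> \<phi> y \<in> children T (\<phi> x)" if "y \<in> ?U" for y
    using iso that x children_subtree[OF T x] children_subtree[OF T \<phi>x]
    unfolding tree_iso_def by metis
  have "children T (\<phi> x) \<subseteq> \<phi> ` ?U"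
    using children_subtree_subset[OF T \<phi>x] bij by (simp add: bij_betw_def)
  then show ?thesis
    using iff children_subtree_subset[OF T x] by blast
qed

text \<open>\<open>tree_iso\<close> does not mention roots. If the preimage of \<open>v\<close> were
  not \<open>u\<close>, it would have a parent in T(u), whose image would be both a parent and a
  descendant of \<open>v\<close>, giving a cycle.\<close>

lemma tree_iso_subtree_root:
  assumes T: "labelled_rooted_tree T"
    and iso: "tree_iso (subtree T u) (subtree T v) \<phi>"
    and v: "v \<in> nodes T"
  shows "\<phi> u = v"
proof -
  have bij: "bij_betw \<phi> (nodes (subtree T u)) (nodes (subtree T v))"
    using iso by (simp add: tree_iso_def)
  then obtain x where x: "x \<in> nodes (subtree T u)" "\<phi> x = v"
    using self_in_subtree[OF v] by (metis bij_betw_def imageE)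
  have "x = u"
  proof (rule ccontr)
    assume "x \<noteq> u"
    then obtain y where y: "(u, y) \<in> (edges T)\<^sup>*" "(y, x) \<in> edges T"
      using x by (auto simp: nodes_subtree elim: rtranclE)
    then have yU: "y \<in> nodes (subtree T u)"
      using T by (auto simp: nodes_subtree labelled_rooted_tree_def)
    then have "(\<phi> y, v) \<in> edges T"
      using tree_iso_subtree_children[OF T iso yU] y(2) x(2) by (auto simp: children_def)
    moreover have "(v, \<phi> y) \<in> (edges T)\<^sup>*"
      using bij yU by (auto simp: bij_betw_def nodes_subtree)
    ultimately show False
      using labelled_rooted_tree_acyclic[OF T] by (meson rtrancl_into_trancl1)
  qed
  with x show ?thesis by simp
qed

text \<open>Justifies the definite description: each value on \<open>attr T1\<close> is forced by a
  node carrying that label, and extensionality fixes all other values.\<close>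

lemma is_cipher_cipher:
  assumes "tree_ciphering T1 T2 \<phi>"
  shows "is_cipher T1 T2 \<phi> (cipher T1 T2 \<phi>)"
proof -
  obtain f where f: "is_cipher T1 T2 \<phi> f"
    using assms by (auto simp: tree_ciphering_def)
  have "g = f" if g: "is_cipher T1 T2 \<phi> g" for g
  proof (rule extensionalityI[of _ "attr T1"])
    show "g \<in> extensional (attr T1)" "f \<in> extensional (attr T1)"
      using f g by (auto simp: is_cipher_def)
    show "g a = f a" if "a \<in> attr T1" for a
      using f g that by (auto simp: is_cipher_def attr_def)
  qed
  with f show ?thesis
    unfolding cipher_def by (rule theI)
qed

section \<open>The tree of paths of a multigraph\<close>

context wf_digraph
begin

lemma Nil_in_paths_from: "S \<in> verts G \<Longrightarrow> [] \<in> paths_from G S"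
  by (auto simp: paths_from_def awalk_Nil_iff)

lemma paths_from_snoc:
  "es @ [e] \<in> paths_from G S \<longleftrightarrow> es \<in> paths_from G S \<and> e \<in> out_arcs G (awlast S es)"
  by (auto simp: paths_from_def awalk_Cons_iff awalk_Nil_iff)

end

lemma edges_decompress_iff:
  assumes "wf_digraph (underlying R)"
  shows "(es, es') \<in> edges (decompress R S) \<longleftrightarrow>
    es' \<in> paths_from (underlying R) S \<and> (\<exists>e. es' = es @ [e])"
  using wf_digraph.paths_from_snoc[OF assms, of _ _ S]
  by (auto simp: decompress_def)

text \<open>Finiteness is assumed because a directed cycle reachable from \<open>S\<close> would
  give infinitely many paths; for the compression it is obtained from the injection into the nodes
  of T.\<close>

lemma labelled_rooted_tree_decompress:
  assumes wf: "wf_digraph (underlying R)" and S: "S \<in> verts (underlying R)"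
    and fin: "finite (paths_from (underlying R) S)"
  shows "labelled_rooted_tree (decompress R S)"
proof -
  interpret wf_digraph "underlying R" by (rule wf)
  let ?P = "paths_from (underlying R) S"
  have nodes: "nodes (decompress R S) = ?P" and root: "root (decompress R S) = []"
    by (simp_all add: decompress_def)
  have reach: "([], es) \<in> (edges (decompress R S))\<^sup>*" if "es \<in> ?P" for es
    using that
  proof (induction es rule: rev_induct)
    case (snoc e es)
    then have "(es, es @ [e]) \<in> edges (decompress R S)"
      by (simp add: edges_decompress_iff[OF wf])
    with snoc show ?case
      by (meson paths_from_snoc rtrancl_into_rtrancl)
  qed simp
  have parent: "\<exists>!es'. (es', es) \<in> edges (decompress R S)" if "es \<in> ?P - {[]}" for es
    using that by (cases es rule: rev_cases) (auto simp: edges_decompress_iff[OF wf])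
  have "edges (decompress R S) \<subseteq> ?P \<times> ?P"
    by (auto simp: edges_decompress_iff[OF wf] paths_from_snoc)
  then show ?thesis
    unfolding labelled_rooted_tree_def nodes root
    using reach parent fin Nil_in_paths_from[OF S]
    by (auto simp: edges_decompress_iff[OF wf])
qed

section \<open>Unfolding the compression\<close>

lemma dag_rw_simps [simp]:
  "verts (underlying (dag_rw T s \<Phi>)) = classes T"
  "arcs (underlying (dag_rw T s \<Phi>)) = rw_edges T s"
  "tail (underlying (dag_rw T s \<Phi>)) (p, q, v) = p"
  "head (underlying (dag_rw T s \<Phi>)) (p, q, v) = q"
  "vertex_label (dag_rw T s \<Phi>) q = label T (s q)"
  "edge_label (dag_rw T s \<Phi>) (p, q, v) =
    cipher (subtree T (s q)) (subtree T v) (\<Phi> (p, q, v))"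
  by (simp_all add: dag_rw_def)

locale dag_rw_compression =
  fixes T :: "('n, 'l) ltree"
    and s :: "('n, 'l) tree_class \<Rightarrow> 'n"
    and \<Phi> :: "('n, 'l) rw_edge \<Rightarrow> 'n \<Rightarrow> 'n"
  assumes tree: "labelled_rooted_tree T"
    and s_nodes: "p \<in> classes T \<Longrightarrow> s p \<in> nodes T"
    and class_s: "p \<in> classes T \<Longrightarrow> node_class T (s p) = p"
    and ciphering: "(p, q, v) \<in> rw_edges T s \<Longrightarrow>
      tree_ciphering (subtree T (s q)) (subtree T v) (\<Phi> (p, q, v))"
begin

abbreviation "R \<equiv> dag_rw T s \<Phi>"

sublocale wf_digraph "underlying R"
  by unfold_locales (auto simp: rw_edges_def)

section \<open>Composing the cipherings along a path\<close>

definition embed :: "('n, 'l) rw_edge list \<Rightarrow> 'n \<Rightarrow> 'n" where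
  "embed es = foldr (\<circ>) (map \<Phi> es) id"

text \<open>Has the shape of the label formula in \<open>decompress\<close>, so that the two agree
  by unfolding.\<close>

definition path_cipher :: "('n, 'l) rw_edge list \<Rightarrow> 'l \<Rightarrow> 'l" where
  "path_cipher es = foldr (\<circ>) (map (edge_label R) es) id"

lemma embed_Cons: "embed (e # es) x = \<Phi> e (embed es x)"
  by (simp add: embed_def)

lemma embed_snoc: "embed (es @ [e]) x = embed es (\<Phi> e x)"
  by (induction es) (simp_all add: embed_def)

text \<open>The middle component of an edge is forced by \<open>v\<close>, so the edges leaving
  \<open>p\<close> are parametrised by the children of \<open>s p\<close>.\<close>

lemma out_arcs_eq:
  assumes "p \<in> classes T"
  shows "out_arcs (underlying R) p = (\<lambda>v. (p, node_class T v, v)) ` children T (s p)"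
proof -
  have "node_class T v \<in> classes T" if "v \<in> children T (s p)" for v
    using children_nodes[OF tree that] by (simp add: classes_def)
  with assms show ?thesis
    by (auto simp: rw_edges_def)
qed

text \<open>Induction on the first edge. The three claims go together: the first keeps
  \<open>embed es x\<close> in the domain of \<open>\<Phi> e\<close>, where the ciphering respects
  children and labels.\<close>

lemma embed_path:
  assumes "awalk p es q" "x \<in> nodes (subtree T (s q))"
  shows "embed es x \<in> nodes (subtree T (s p))"
    and "children T (embed es x) = embed es ` children T x"
    and "label T (embed es x) = path_cipher es (label T x)"
  using assms
proof (induction es arbitrary: p)
  case Nil
  { case 1 then show ?case by (simp add: awalk_Nil_iff embed_def) }
  { case 2 then show ?case by (simp add: embed_def) }
  { case 3 then show ?case by (simp add: embed_def path_cipher_def) }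
next
  case (Cons e es)
  obtain p' r v where e: "e = (p', r, v)" by (cases e)
  \<comment> \<open>The start \<open>p\<close> stays general here, since each of the three goals
    fixes its own.\<close>
  have step: "\<Phi> e y \<in> nodes (subtree T (s p)) \<and> children T (\<Phi> e y) = \<Phi> e ` children T y \<and>
      label T (\<Phi> e y) = edge_label R e (label T y)"
    if walk: "awalk p (e # es) q" and y: "y \<in> nodes (subtree T (s r))" for p y
  proof -
    have edge: "(p, r, v) \<in> rw_edges T s" and p': "p' = p"
      using walk e by (auto simp: awalk_Cons_iff)
    note ciph = ciphering[OF edge]
    then have iso: "tree_iso (subtree T (s r)) (subtree T v) (\<Phi> e)"
      using e p' by (simp add: tree_ciphering_def)
    \<comment> \<open>The target T(v) of \<open>\<Phi> e\<close> hangs below \<open>s p\<close>,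
      because \<open>v\<close> is a child of \<open>s p\<close>.\<close>
    have "nodes (subtree T v) \<subseteq> nodes (subtree T (s p))"
      using edge by (intro subtree_mono) (simp add: rw_edges_def)
    moreover have "\<Phi> e y \<in> nodes (subtree T v)"
      using iso y by (auto simp: tree_iso_def bij_betw_def)
    moreover have "label T (\<Phi> e y) = edge_label R e (label T y)"
      using is_cipher_cipher[OF ciph] y e p' by (simp add: is_cipher_def)
    ultimately show ?thesis
      using tree_iso_subtree_children[OF tree iso y] by blast
  qed
  have tail: "awalk r es q" if "awalk p (e # es) q" for p
    using that e by (auto simp: awalk_Cons_iff)
  { case 1 then show ?case using step Cons.IH(1)[OF tail] by (simp add: embed_Cons) }
  { case 2 then show ?case using step Cons.IH(1,2)[OF tail] by (simp add: embed_Cons image_image) }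
  { case 3 then show ?case using step Cons.IH(1,3)[OF tail] by (simp add: embed_Cons path_cipher_def) }
qed

text \<open>A composite of injections; \<open>embed_path(1)\<close> ensures that each factor is
  applied inside its domain.\<close>

lemma inj_on_embed:
  assumes "awalk p es q"
  shows "inj_on (embed es) (nodes (subtree T (s q)))"
  using assms
proof (induction es arbitrary: p)
  case Nil
  then show ?case by (simp add: embed_def)
next
  case (Cons e es)
  obtain r v where e: "e = (p, r, v)" and edge: "(p, r, v) \<in> rw_edges T s" and "awalk r es q"
    using Cons.prems by (cases e) (auto simp: awalk_Cons_iff)
  have "inj_on (\<Phi> e) (nodes (subtree T (s r)))"
    using ciphering[OF edge] e by (auto simp: tree_ciphering_def tree_iso_def bij_betw_def)
  with Cons.IH[OF \<open>awalk r es q\<close>] embed_path(1)[OF \<open>awalk r es q\<close>] show ?case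
    by (auto simp: embed_Cons inj_on_def)
qed

section \<open>The node of T reached by a path\<close>

abbreviation "S \<equiv> node_class T (root T)"

abbreviation "P \<equiv> paths_from (underlying R) S"

definition path_node :: "('n, 'l) rw_edge list \<Rightarrow> 'n" where
  "path_node es = embed es (s (awlast S es))"

lemma S_class: "S \<in> classes T"
  using tree by (simp add: classes_def labelled_rooted_tree_def)

lemma P_awalk: "es \<in> P \<Longrightarrow> awalk S es (awlast S es)"
  by (auto simp: paths_from_def)

lemma awlast_classes: "es \<in> P \<Longrightarrow> awlast S es \<in> classes T"
  using awalk_last_in_verts[OF P_awalk] by simp

text \<open>No node but the root lies in the class \<open>S\<close>, so \<open>s S\<close> is the
  root.\<close>

lemma path_node_Nil: "path_node [] = root T"
  using node_class_eq_root_class_iff[OF tree s_nodes[OF S_class]] class_s[OF S_class]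
  by (simp add: path_node_def embed_def)

lemma path_node_snoc:
  assumes "es \<in> P" "v \<in> children T (s (awlast S es))"
  shows "path_node (es @ [(awlast S es, node_class T v, v)]) = embed es v"
proof -
  define p where "p = awlast S es"
  define q where "q = node_class T v"
  have e: "(p, q, v) \<in> out_arcs (underlying R) p"
    using assms out_arcs_eq[OF awlast_classes] by (simp add: p_def q_def)
  then have edge: "(p, q, v) \<in> rw_edges T s"
    by simp
  have "awlast S (es @ [(p, q, v)]) = q"
    using e P_awalk[OF assms(1)] by (auto simp: p_def awlast_append)
  \<comment> \<open>Root goes to root, so the innermost factor of the extended path turns
    \<open>s q\<close> into \<open>v\<close>.\<close>
  moreover have "\<Phi> (p, q, v) (s q) = v"
    using tree_iso_subtree_root[OF tree] ciphering[OF edge] children_nodes[OF tree assms(2)]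
    by (simp add: tree_ciphering_def)
  ultimately show ?thesis
    by (simp add: path_node_def embed_snoc flip: p_def q_def)
qed

lemma s_awlast_in_subtree:
  "es \<in> P \<Longrightarrow> s (awlast S es) \<in> nodes (subtree T (s (awlast S es)))"
  by (intro self_in_subtree s_nodes awlast_classes)

lemma children_path_node:
  assumes "es \<in> P"
  shows "children T (path_node es) = embed es ` children T (s (awlast S es))"
  unfolding path_node_def
  by (rule embed_path(2)[OF P_awalk[OF assms] s_awlast_in_subtree[OF assms]])

text \<open>Trades the last edge for a child \<open>v\<close> of the representative, the form used
  when arguing by the last edge.\<close>

lemma P_snocE:
  assumes "es @ [e] \<in> P"
  obtains v where "es \<in> P" "v \<in> children T (s (awlast S es))"
    "e = (awlast S es, node_class T v, v)" "path_node (es @ [e]) = embed es v"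
proof -
  have es: "es \<in> P" and "e \<in> out_arcs (underlying R) (awlast S es)"
    using assms by (simp_all add: paths_from_snoc)
  then obtain v where v: "v \<in> children T (s (awlast S es))"
    and e: "e = (awlast S es, node_class T v, v)"
    unfolding out_arcs_eq[OF awlast_classes[OF es]] by (rule_tac imageE)
  show thesis
    by (rule that[OF es v e]) (simp only: e path_node_snoc[OF es v])
qed

lemma path_node_snoc_edge:
  assumes "es @ [e] \<in> P"
  shows "(path_node es, path_node (es @ [e])) \<in> edges T"
  using assms children_path_node by (elim P_snocE) (auto simp: children_def)

text \<open>Induction on the last edge: unique parents identify the prefixes, then injectivity of
  \<open>embed es\<close> identifies the last children.\<close>

lemma inj_on_path_node: "inj_on path_node P"
proof (rule inj_onI)
  \<comment> \<open>A nonempty path reaches a node with a parent, which the root lacks; this settles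
    comparisons with the empty path.\<close>
  have not_root: "path_node (es @ [e]) \<noteq> root T" if "es @ [e] \<in> P" for es e
    using path_node_snoc_edge[OF that] tree unfolding labelled_rooted_tree_def by metis
  show "es = fs" if "es \<in> P" "fs \<in> P" "path_node es = path_node fs" for es fs
    using that
  proof (induction es arbitrary: fs rule: rev_induct)
    case Nil
    then show ?case
      using not_root by (cases fs rule: rev_cases) (auto simp: path_node_Nil)
  next
    case (snoc e es)
    then obtain f fs' where fs: "fs = fs' @ [f]"
      using not_root by (cases fs rule: rev_cases) (auto simp: path_node_Nil)
    have "path_node es = path_node fs'"
      using path_node_snoc_edge snoc.prems parent_unique[OF tree] unfolding fs by metis
    then have eq: "es = fs'"
      using snoc fs by (simp add: paths_from_snoc)
    obtain v where v: "es \<in> P" "v \<in> children T (s (awlast S es))"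
      "e = (awlast S es, node_class T v, v)" "path_node (es @ [e]) = embed es v"
      using snoc.prems(1) by (rule P_snocE)
    obtain w where w: "w \<in> children T (s (awlast S es))"
      "f = (awlast S es, node_class T w, w)" "path_node (es @ [f]) = embed es w"
      using snoc.prems(2) unfolding fs eq by (rule P_snocE)
    have "embed es v = embed es w"
      using snoc.prems(3) v w fs eq by simp
    then have "v = w"
      using inj_on_embed[OF P_awalk[OF v(1)]]
        children_subtree_subset[OF tree s_awlast_in_subtree[OF v(1)]] v(2) w(1)
      by (meson inj_onD subsetD)
    \<comment> \<open>The child determines its class and hence the whole last edge.\<close>
    then show ?case
      using v w fs eq by simp
  qed
qed

text \<open>For surjectivity, follow the tree from the root: a child of a reached node is
  \<open>embed es v\<close> for some child \<open>v\<close> of the representative, and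
  \<open>v\<close> names the edge that prolongs the path.\<close>

lemma path_node_image: "path_node ` P = nodes T"
proof (intro equalityI subsetI)
  fix x assume "x \<in> path_node ` P"
  then show "x \<in> nodes T"
    using embed_path(1)[OF P_awalk s_awlast_in_subtree]
    by (auto simp: path_node_def nodes_subtree)
next
  fix x assume "x \<in> nodes T"
  then have "(root T, x) \<in> (edges T)\<^sup>*"
    using tree by (simp add: labelled_rooted_tree_def)
  then show "x \<in> path_node ` P"
  proof (induction rule: rtrancl_induct)
    case base
    show ?case
      using Nil_in_paths_from S_class path_node_Nil by force
  next
    case (step y z)
    then obtain es where es: "es \<in> P" "y = path_node es" by blast
    then have "z \<in> embed es ` children T (s (awlast S es))"
      using step.hyps(2) children_path_node[OF es(1)] by (auto simp: children_def)
    then obtain v where v: "v \<in> children T (s (awlast S es))" "z = embed es v" by blast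
    then have "es @ [(awlast S es, node_class T v, v)] \<in> P"
      using es out_arcs_eq[OF awlast_classes[OF es(1)]] by (simp add: paths_from_snoc)
    then show ?case
      using path_node_snoc[OF es(1) v(1)] v(2) by (metis imageI)
  qed
qed

text \<open>From left to right, the prefix of \<open>fs\<close> and \<open>es\<close> both reach the
  unique parent, so they coincide by injectivity.\<close>

lemma path_node_edge_iff:
  assumes "es \<in> P" "fs \<in> P"
  shows "(path_node es, path_node fs) \<in> edges T \<longleftrightarrow> (\<exists>e. fs = es @ [e])"
proof
  assume edge: "(path_node es, path_node fs) \<in> edges T"
  show "\<exists>e. fs = es @ [e]"
  proof (cases fs rule: rev_cases)
    case Nil
    then show ?thesis
      using edge tree by (simp add: path_node_Nil labelled_rooted_tree_def)
  next
    case (snoc fs' f)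
    then have "path_node fs' = path_node es"
      using edge path_node_snoc_edge parent_unique[OF tree] assms(2) by metis
    then have "fs' = es"
      using snoc assms inj_on_path_node by (auto simp: paths_from_snoc dest: inj_onD)
    with snoc show ?thesis by blast
  qed
qed (use assms path_node_snoc_edge in blast)

lemma labelled_tree_iso_path_node: "labelled_tree_iso (decompress R S) T path_node"
proof -
  have "label T (path_node es) = label (decompress R S) es" if "es \<in> P" for es
    using embed_path(3)[OF P_awalk[OF that] s_awlast_in_subtree[OF that]]
    by (simp add: path_node_def path_cipher_def decompress_def)
  moreover have "nodes (decompress R S) = P"
    by (simp add: decompress_def)
  ultimately show ?thesis
    using inj_on_path_node path_node_image path_node_edge_iff
    by (auto simp: labelled_tree_iso_def tree_iso_def bij_betw_def children_def
        edges_decompress_iff[OF wf_digraph_axioms])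
qed

lemma labelled_rooted_tree_decompress_dag_rw: "labelled_rooted_tree (decompress R S)"
proof (rule labelled_rooted_tree_decompress[OF wf_digraph_axioms])
  show "S \<in> verts (underlying R)"
    using S_class by simp
  have "finite (nodes T)"
    using tree by (simp add: labelled_rooted_tree_def)
  \<comment> \<open>\<open>path_node\<close> injects the paths into the finite node set of
    T.\<close>
  then show "finite P"
    using inj_on_path_node path_node_image by (metis finite_imageD)
qed

end

theorem theorem2:
  fixes T :: "('n, 'l) ltree"
    and s :: "('n, 'l) tree_class \<Rightarrow> 'n"
    and \<Phi> :: "('n, 'l) rw_edge \<Rightarrow> 'n \<Rightarrow> 'n"
    and S :: "('n, 'l) tree_class"
  assumes "labelled_rooted_tree T"
    and "S = node_class T (root T)"
    and "s \<in> classes T \<rightarrow> nodes T"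
    and "inj_on s (classes T)"
    and "\<forall>a \<in> classes T. node_class T (s a) = a"
    and "\<forall>q \<in> classes T - {S}. \<exists>p \<in> classes T.
           (p, q) \<in> arcs_ends (reduction_graph T) \<and> s q \<in> children T (s p)"
    and "\<forall>(p, q, v) \<in> rw_edges T s.
           tree_ciphering (subtree T (s q)) (subtree T v) (\<Phi> (p, q, v))"
    and "\<forall>(p, q, v) \<in> rw_edges T s. v = s q \<longrightarrow>
           (\<forall>a \<in> attr (subtree T (s q)).
              cipher (subtree T (s q)) (subtree T v) (\<Phi> (p, q, v)) a = a)"
  shows "labelled_rooted_tree (decompress (dag_rw T s \<Phi>) S) \<and>
         (\<exists>\<psi>. labelled_tree_iso (decompress (dag_rw T s \<Phi>) S) T \<psi>)"
proof -
  interpret dag_rw_compression T s \<Phi>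
    using assms(1,3,5,7) by unfold_locales auto
  show ?thesis
    unfolding assms(2)
    using labelled_rooted_tree_decompress_dag_rw labelled_tree_iso_path_node by blast
qed

end
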